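(* For every finite non-empty set $\Lambda$ and every finite non-empty set $\mathsf{C}$, $$\mathrm{HJ}_{\mathsf{C}}(1,\Lambda)\;\le\; \mathtt{f}^{8,\ast}_{\Lambda}\Big(|\Lambda|^2\cdot \mathrm{W}_{\mathsf{C}}(|\Lambda|,1),\ \mathsf{C}\Big).$$
   Context: For a natural number $n$ identify $n=\{0,\dots,n-1\}$. For a finite non-empty linear order $M$ and a finite non-empty set $\Lambda$ (alphabet), $\mathcal{U}_{M,\Lambda}$ is the set of all functions $\eta:M\to\Lambda$. For pairwise disjoint non-empty subsets $M_\ell$ ($\ell<m$) of $M$ and a map $\rho:M\setminus\bigcup_{\ell<m}M_\ell\to\Lambda$, the $m$-dimensional subspace $\mathcal{S}(\langle M_\ell:\ell<m\rangle,\rho)$ is the set of $\nu\in\mathcal{U}_{M,\Lambda}$ with $\nu\restriction (M\setminus\bigcup_\ell M_\ell)=\rho$ and $\nu\restriction M_\ell$ constant for each $\ell<m$; a line is a $1$-dimensional subspace. $\mathsf{C}$ is a finite non-empty set of colors. The Hales–Jewett number $\mathrm{HJ}_{\mathsf{C}}(m,\Lambda)$ is the least $k$ such that for every linear order $M$ of size $k$ and every coloring $\mathbf{d}:\mathcal{U}_{M,\Lambda}\to\mathsf{C}$ there is a $\mathbf{d}$-monochromatic $m$-dimensional subspace of $\mathcal{U}_{M,\Lambda}$. The Gallai–Witt number $\mathrm{W}_{\mathsf{C}}(h,m)$ is the least $n$ such that for every coloring $\mathbf{d}:\mathcal{U}_{h,n}\to\mathsf{C}$ (functions from $\{0,\dots,h-1\}$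 to $\{0,\dots,n-1\}$) there are $d>0$ and natural numbers $\langle m_e:e<h\rangle$ with $m_e+d\cdot m<n$ for each $e<h$ such that $\mathbf{d}$ is constant on $\{\langle m_e+d\cdot i_e: e<h\rangle : i_0,\dots,i_{h-1}\le m\}$. For $m$ divisible by $|\Lambda|$, $\mathtt{f}^{8,\ast}_{\Lambda}(m,\mathsf{C})$ is the least $k$ divisible by $|\Lambda|$ such that for every linear order $M$ of size $k$ and every coloring $\mathbf{d}:\mathcal{U}_{M,\Lambda}\to\mathsf{C}$ there are pairwise disjoint non-empty subsets $M_\ell$ ($\ell<m$) of $M$ and a map $\rho:M\setminus\bigcup_{\ell<m}M_\ell\to\Lambda$ such that for all $\nu_1,\nu_2\in\mathcal{S}(\langle M_\ell:\ell<m\rangle,\rho)$, $\mathbf{d}(\nu_1)=\mathbf{d}(\nu_2)$ whenever for every $\alpha\in\Lambda$, $|\{\ell<m:\nu_1\restriction M_\ell\equiv\alpha\}|=|\{\ell<m:\nu_2\restriction M_\ell\equiv\alpha\}|$. *)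

theory Defs
  imports "HOL-Analysis.Analysis"
begin

text \<open>
  Functions with domain \<open>M\<close> are extensional: they take the value \<open>undefined\<close> outside \<open>M\<close>, so that
  equality of such functions is equality of set-theoretic functions on \<open>M\<close>.
\<close>

definition words :: "'i set \<Rightarrow> 'a set \<Rightarrow> ('i \<Rightarrow> 'a) set" where
  "words M \<Lambda> = M \<rightarrow>\<^sub>E \<Lambda>"

definition subspace_data ::
    "'i set \<Rightarrow> 'a set \<Rightarrow> nat \<Rightarrow> (nat \<Rightarrow> 'i set) \<Rightarrow> ('i \<Rightarrow> 'a) \<Rightarrow> bool" where
  "subspace_data M \<Lambda> m N \<rho> \<longleftrightarrow>
     (\<forall>l<m. N l \<noteq> {} \<and> N l \<subseteq> M) \<and>
     disjoint_family_on N {..<m} \<and>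
     \<rho> \<in> (M - (\<Union>l<m. N l)) \<rightarrow>\<^sub>E \<Lambda>"

definition word_subspace ::
    "'i set \<Rightarrow> 'a set \<Rightarrow> nat \<Rightarrow> (nat \<Rightarrow> 'i set) \<Rightarrow> ('i \<Rightarrow> 'a) \<Rightarrow> ('i \<Rightarrow> 'a) set" where
  "word_subspace M \<Lambda> m N \<rho> =
     {\<nu> \<in> words M \<Lambda>. restrict \<nu> (M - (\<Union>l<m. N l)) = \<rho> \<and> (\<forall>l<m. \<nu> constant_on N l)}"

text \<open>
  Up to isomorphism every finite linear order lives on a set of natural numbers, so quantifying over
  all \<open>M :: nat set\<close> and all linear orders \<open>r\<close> on \<open>M\<close> covers all of them. The
  condition \<open>0 < k\<close> reflects that \<open>M\<close> ranges over non-empty orders.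
\<close>

definition HJ_property :: "'c set \<Rightarrow> nat \<Rightarrow> 'a set \<Rightarrow> nat \<Rightarrow> bool" where
  "HJ_property C m \<Lambda> k \<longleftrightarrow>
     (\<forall>(M :: nat set) r. linear_order_on M r \<and> card M = k \<longrightarrow>
       (\<forall>d \<in> words M \<Lambda> \<rightarrow> C.
          \<exists>N \<rho>. subspace_data M \<Lambda> m N \<rho> \<and> d constant_on word_subspace M \<Lambda> m N \<rho>))"

definition HJ :: "'c set \<Rightarrow> nat \<Rightarrow> 'a set \<Rightarrow> nat" where
  "HJ C m \<Lambda> = (LEAST k. 0 < k \<and> HJ_property C m \<Lambda> k)"

definition GW_property :: "'c set \<Rightarrow> nat \<Rightarrow> nat \<Rightarrow> nat \<Rightarrow> bool" where
  "GW_property C h m n \<longleftrightarrow>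
     (\<forall>c \<in> words {..<h} {..<n} \<rightarrow> C.
        \<exists>d>0. \<exists>b :: nat \<Rightarrow> nat.
          (\<forall>e<h. b e + d * m < n) \<and>
          c constant_on {(\<lambda>e\<in>{..<h}. b e + d * i e) | i. \<forall>e<h. i e \<le> m})"

definition GW :: "'c set \<Rightarrow> nat \<Rightarrow> nat \<Rightarrow> nat" where
  "GW C h m = (LEAST n. GW_property C h m n)"

definition letter_count :: "nat \<Rightarrow> (nat \<Rightarrow> 'i set) \<Rightarrow> ('i \<Rightarrow> 'a) \<Rightarrow> 'a \<Rightarrow> nat" where
  "letter_count m N \<nu> \<alpha> = card {l. l < m \<and> (\<forall>x\<in>N l. \<nu> x = \<alpha>)}"

definition f8_property :: "'a set \<Rightarrow> nat \<Rightarrow> 'c set \<Rightarrow> nat \<Rightarrow> bool" where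
  "f8_property \<Lambda> m C k \<longleftrightarrow>
     (\<forall>(M :: nat set) r. linear_order_on M r \<and> card M = k \<longrightarrow>
       (\<forall>d \<in> words M \<Lambda> \<rightarrow> C.
          \<exists>N \<rho>. subspace_data M \<Lambda> m N \<rho> \<and>
            (\<forall>\<nu>1 \<in> word_subspace M \<Lambda> m N \<rho>. \<forall>\<nu>2 \<in> word_subspace M \<Lambda> m N \<rho>.
               (\<forall>\<alpha>\<in>\<Lambda>. letter_count m N \<nu>1 \<alpha> = letter_count m N \<nu>2 \<alpha>) \<longrightarrow> d \<nu>1 = d \<nu>2)))"

definition f8_star :: "'a set \<Rightarrow> nat \<Rightarrow> 'c set \<Rightarrow> nat" where
  "f8_star \<Lambda> m C = (LEAST k. 0 < k \<and> card \<Lambda> dvd k \<and> f8_property \<Lambda> m C k)"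

end

theory Submission
  imports Defs
begin

text \<open>
  Put \<open>h = |\<Lambda>|\<close> and \<open>n = W(h, 1)\<close>. On a subspace of dimension \<open>h\<^sup>2 n\<close> where the colour depends only
  on the letter counts, the colouring becomes a colouring of count vectors, which pulls back along an
  affine map to \<open>{0..<n}\<^sup>h\<close>. A monochromatic homothetic copy of \<open>{0, 1}\<^sup>h\<close> there contains the points
  \<open>b + D 1\<^sub>e\<close>, and these are the count vectors of the points of a line. That the least numbers in
  question exist follows from the Hales-Jewett theorem, proved here by Shelah's argument.
\<close>

section \<open>Words as lists, and templates for subspaces\<close>

text \<open>Lists replace functions on \<open>M\<close> here because the Hales-Jewett argument
  concatenates words; \<open>HJ_property_eventually\<close> translates back.\<close>

definition cube :: "'a set \<Rightarrow> nat \<Rightarrow> 'a list set" where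
  "cube A K = {w. set w \<subseteq> A \<and> length w = K}"

text \<open>
  In a template \<open>Inl x\<close> is the fixed letter \<open>x\<close> and \<open>Inr i\<close> is the variable \<open>i\<close>, so \<open>{l. \<tau> ! l = Inr i}\<close>
  is the \<open>i\<close>-th moving block of the subspace.
\<close>

definition template :: "'a set \<Rightarrow> nat \<Rightarrow> nat \<Rightarrow> ('a + nat) list \<Rightarrow> bool" where
  "template A n K \<tau> \<longleftrightarrow> length \<tau> = K \<and> set \<tau> \<subseteq> A <+> {..<n} \<and> Inr ` {..<n} \<subseteq> set \<tau>"

definition subst :: "('a + nat) list \<Rightarrow> (nat \<Rightarrow> 'a) \<Rightarrow> 'a list" where
  "subst \<tau> v = map (case_sum id v) \<tau>"

lemma finite_cube: "finite A \<Longrightarrow> finite (cube A K)"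
  unfolding cube_def by (rule finite_lists_length_eq)

lemma append_in_cube: "u \<in> cube A m \<Longrightarrow> w \<in> cube A n \<Longrightarrow> u @ w \<in> cube A (m + n)"
  by (auto simp: cube_def)

lemma template_nth:
  assumes "template A n K \<tau>" "i < K"
  shows "\<tau> ! i \<in> A <+> {..<n}"
proof -
  have "\<tau> ! i \<in> set \<tau>" "set \<tau> \<subseteq> A <+> {..<n}"
    using assms by (simp_all add: template_def)
  then show ?thesis by (rule rev_subsetD)
qed

lemma subst_append: "subst (\<sigma> @ \<tau>) v = subst \<sigma> v @ subst \<tau> v"
  by (simp add: subst_def)

lemma subst_in_cube:
  assumes "template A n K \<tau>" "\<And>i. i < n \<Longrightarrow> v i \<in> A"
  shows "subst \<tau> v \<in> cube A K"
proof -
  have "case_sum id v z \<in> A" if "z \<in> A <+> {..<n}" for z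
    using that assms(2) by auto
  then show ?thesis
    using assms(1) by (auto simp: cube_def template_def subst_def)
qed

lemma subst_cong:
  assumes "template A n K \<tau>" "\<And>i. i < n \<Longrightarrow> v i = v' i"
  shows "subst \<tau> v = subst \<tau> v'"
proof -
  have "case_sum id v z = case_sum id v' z" if "z \<in> A <+> {..<n}" for z
    using that assms(2) by auto
  then show ?thesis
    using assms(1) by (auto simp: template_def subst_def)
qed

text \<open>In Shelah's induction the colours turn into functions. Coding them as numbers keeps one
  colour type throughout, so that only the bound \<open>r\<close> varies.\<close>

lemma finite_colours_to_nat:
  assumes "finite F"
  obtains g :: "'b \<Rightarrow> nat" where "inj_on g F" "\<And>x. x \<in> F \<Longrightarrow> g x < card F"
proof -
  obtain g where "bij_betw g F {0..<card F}"
    using ex_bij_betw_finite_nat[OF assms] by blast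
  then show ?thesis
    by (intro that[of g]) (auto simp: bij_betw_def)
qed

section \<open>The Hales-Jewett theorem for lines\<close>

text \<open>
  Shelah's step: the words \<open>a\<^sup>j b\<^bsup>N-j\<^esup>\<close> outnumber the colourings of the
  remaining coordinates, so two of them are indistinguishable.
\<close>

lemma swap_invariant_template:
  fixes A :: "'a set"
  assumes A: "finite A" "a \<in> A" "b \<in> A"
  shows "\<exists>K. \<forall>d :: 'a list \<Rightarrow> nat. (\<forall>w\<in>cube A K. d w < r) \<longrightarrow>
    (\<exists>\<tau>. template A n K \<tau> \<and>
      (\<forall>v i. (\<forall>j<n. v j \<in> A) \<and> i < n \<longrightarrow> d (subst \<tau> (v(i := a))) = d (subst \<tau> (v(i := b)))))"
proof (induction n arbitrary: r)
  case 0
  show ?case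
    by (rule exI[of _ 0]) (auto simp: template_def)
next
  case (Suc n)
  define V where "V = {..<n} \<rightarrow>\<^sub>E A"
  define G where "G = V \<rightarrow>\<^sub>E {..<r}"
  \<comment> \<open>The prefix has as many letters as there are \<open>r\<close>-colourings of the
    \<open>n\<close>-dimensional space \<open>V\<close>. \<open>N\<close> is fixed before
    \<open>K\<close>, since the colours given to the induction hypothesis are the colourings in
    \<open>F\<close> of all prefixes.\<close>
  define N where "N = card G"
  define F where "F = cube A N \<rightarrow>\<^sub>E {..<r}"
  have finG: "finite G"
    unfolding G_def V_def by (intro finite_PiE A) auto
  have finF: "finite F"
    unfolding F_def by (intro finite_PiE finite_cube A) auto
  obtain g where g: "inj_on g F" "\<And>x. x \<in> F \<Longrightarrow> g x < card F"
    using finite_colours_to_nat[OF finF] by metis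
  obtain K where K: "\<And>d :: 'a list \<Rightarrow> nat. (\<forall>w\<in>cube A K. d w < card F) \<Longrightarrow>
    (\<exists>\<tau>. template A n K \<tau> \<and>
      (\<forall>v i. (\<forall>j<n. v j \<in> A) \<and> i < n \<longrightarrow> d (subst \<tau> (v(i := a))) = d (subst \<tau> (v(i := b)))))"
    using Suc.IH[of "card F"] by metis
  show ?case
  proof (intro exI[of _ "N + K"] allI impI)
    fix d :: "'a list \<Rightarrow> nat"
    assume d: "\<forall>w\<in>cube A (N + K). d w < r"
    \<comment> \<open>Colouring \<open>w\<close> by its whole behaviour over all prefixes makes the
      invariance of \<open>\<tau>\<close> hold for every prefix \<open>u\<close> at once.\<close>
    define f where "f w = (\<lambda>u\<in>cube A N. d (u @ w))" for w
    have f: "f w \<in> F" if "w \<in> cube A K" for w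
      using that d append_in_cube[of _ A N w K] unfolding f_def F_def by auto
    obtain \<tau> where \<tau>: "template A n K \<tau>"
      and swap: "\<And>v i. (\<forall>j<n. v j \<in> A) \<Longrightarrow> i < n \<Longrightarrow>
        g (f (subst \<tau> (v(i := a)))) = g (f (subst \<tau> (v(i := b))))"
      using K[of "g \<circ> f"] f g(2) by auto
    have swap': "d (u @ subst \<tau> (v(i := a))) = d (u @ subst \<tau> (v(i := b)))"
      if "\<forall>j<n. v j \<in> A" "i < n" "u \<in> cube A N" for v i u
    proof -
      have "f (subst \<tau> (v(i := a))) = f (subst \<tau> (v(i := b)))"
        by (rule inj_onD[OF g(1), OF swap[OF that(1,2)]])
          (use that A in \<open>auto intro!: f subst_in_cube[OF \<tau>]\<close>)
      then show ?thesis
        using that(3) by (auto simp: f_def dest: fun_cong[where x = u])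
    qed
    define p where "p j = replicate j a @ replicate (N - j) b" for j
    have p: "p j \<in> cube A N" if "j \<le> N" for j
      using that A by (auto simp: p_def cube_def)
    \<comment> \<open>The colouring that the prefix \<open>p j\<close> induces on the subspace of
      \<open>\<tau>\<close>. There are \<open>N + 1\<close> prefixes and only \<open>N\<close>
      possible colourings.\<close>
    define q where "q j = (\<lambda>v\<in>V. d (p j @ subst \<tau> v))" for j
    have q: "q j \<in> G" if "j \<le> N" for j
    proof -
      have "d (p j @ subst \<tau> v) < r" if "v \<in> V" for v
        using d append_in_cube[OF p[OF \<open>j \<le> N\<close>] subst_in_cube[OF \<tau>]] that
        by (auto simp: V_def)
      then show ?thesis by (auto simp: q_def G_def)
    qed
    have "\<not> inj_on q {..N}"
    proof
      assume "inj_on q {..N}"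
      then have "card {..N} \<le> card G"
        by (rule card_inj_on_le) (use q finG in auto)
      then show False by (simp add: N_def)
    qed
    then obtain j j' where j: "j < j'" "j' \<le> N" "q j = q j'"
      unfolding inj_on_def by (metis atMost_iff linorder_neqE_nat)
    \<comment> \<open>The words \<open>p j\<close> and \<open>p j'\<close> differ only in the
      positions from \<open>j\<close> up to \<open>j'\<close>. These become the new variable
      \<open>n\<close>: the letter \<open>a\<close> there gives \<open>p j'\<close> and
      \<open>b\<close> gives \<open>p j\<close>.\<close>
    define \<sigma> where
      "\<sigma> = replicate j (Inl a) @ replicate (j' - j) (Inr n) @ replicate (N - j') (Inl b) @ \<tau>"
    have sub: "subst \<sigma> v =
        (replicate j a @ replicate (j' - j) (v n) @ replicate (N - j') b) @ subst \<tau> v" for v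
      by (simp add: \<sigma>_def subst_def)
    have "template A (Suc n) (N + K) \<sigma>"
      using \<tau> j A by (fastforce simp: template_def \<sigma>_def less_Suc_eq)
    moreover have "d (subst \<sigma> (v(i := a))) = d (subst \<sigma> (v(i := b)))"
      if v: "\<forall>j<Suc n. v j \<in> A" and i: "i < Suc n" for v i
    proof (cases "i < n")
      case True
      then show ?thesis
        unfolding sub using v j A
        by (auto simp: cube_def simp del: append_assoc intro!: swap')
    next
      case False
      then have i: "i = n" using i by simp
      \<comment> \<open>\<open>q j\<close> looks only at extensional assignments, so the value at
        \<open>n\<close>, which \<open>\<tau>\<close> does not mention, is cut off.\<close>
      have ext: "subst \<tau> (v(n := x)) = subst \<tau> (restrict v {..<n})" for x
        by (rule subst_cong[OF \<tau>]) auto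
      have "restrict v {..<n} \<in> V"
        using v by (auto simp: V_def)
      then have "d (p j @ subst \<tau> (restrict v {..<n})) = d (p j' @ subst \<tau> (restrict v {..<n}))"
        using fun_cong[OF j(3), of "restrict v {..<n}"] by (simp add: q_def)
      moreover have "p j' = replicate j a @ replicate (j' - j) a @ replicate (N - j') b"
        using j by (simp add: p_def flip: append_assoc replicate_add)
      moreover have "p j = replicate j a @ replicate (j' - j) b @ replicate (N - j') b"
        using j by (simp add: p_def flip: replicate_add)
      ultimately show ?thesis
        unfolding sub i ext by simp
    qed
    ultimately show "\<exists>\<tau>. template A (Suc n) (N + K) \<tau> \<and>
      (\<forall>v i. (\<forall>j<Suc n. v j \<in> A) \<and> i < Suc n \<longrightarrow>
        d (subst \<tau> (v(i := a))) = d (subst \<tau> (v(i := b))))"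
      by blast
  qed
qed

text \<open>Coordinates are exchanged one at a time: the induction hypothesis for
  \<open>v(i := a)\<close> handles \<open>S\<close>, then \<open>swap\<close> handles
  \<open>i\<close>.\<close>

lemma swap_invariant_override:
  assumes swap: "\<And>v i. (\<forall>j<n. v j \<in> A) \<Longrightarrow> i < n \<Longrightarrow> f (v(i := a)) = f (v(i := b))"
    and S: "finite S" "S \<subseteq> {..<n}" and A: "a \<in> A" "b \<in> A" and v: "\<forall>j<n. v j \<in> A"
  shows "f (override_on v (\<lambda>_. a) S) = f (override_on v (\<lambda>_. b) S)"
  using S v
proof (induction S arbitrary: v rule: finite_induct)
  case empty
  show ?case by simp
next
  case (insert i S)
  have upd: "override_on v (\<lambda>_. x) (insert i S) = override_on (v(i := x)) (\<lambda>_. x) S" for x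
    by (auto simp: override_on_def)
  have com: "override_on (v(i := x)) (\<lambda>_. y) S = (override_on v (\<lambda>_. y) S)(i := x)" for x y
    using insert.hyps by (auto simp: override_on_def)
  have "f (override_on (v(i := a)) (\<lambda>_. a) S) = f (override_on (v(i := a)) (\<lambda>_. b) S)"
    using insert A by auto
  also have "\<dots> = f (override_on (v(i := b)) (\<lambda>_. b) S)"
    unfolding com using insert A by (intro swap) (auto simp: override_on_def)
  finally show ?case unfolding upd .
qed

text \<open>Induction on the alphabet. To add \<open>b\<close>, fix an old letter \<open>a\<close>
  and pass to a subspace, of a dimension \<open>n\<close> that suffices for \<open>A\<close>, where
  exchanging \<open>a\<close> and \<open>b\<close> in a variable preserves the colour. A line found
  there with letters from \<open>A\<close> has at \<open>b\<close> the same colour as at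
  \<open>a\<close>.\<close>

lemma hales_jewett_line_nat:
  fixes A :: "'a set"
  assumes "finite A" "A \<noteq> {}"
  shows "\<exists>K. \<forall>d :: 'a list \<Rightarrow> nat. (\<forall>w\<in>cube A K. d w < r) \<longrightarrow>
    (\<exists>\<tau>. template A 1 K \<tau> \<and> (\<forall>x\<in>A. \<forall>y\<in>A. d (subst \<tau> (\<lambda>_. x)) = d (subst \<tau> (\<lambda>_. y))))"
  using assms
proof (induction A rule: finite_ne_induct)
  case (singleton x)
  show ?case
    by (intro exI[of _ 1] allI impI exI[of _ "[Inr 0]"]) (auto simp: template_def)
next
  case (insert b A)
  obtain a where a: "a \<in> A" using insert.hyps by auto
  obtain n where n: "\<And>d :: 'a list \<Rightarrow> nat. (\<forall>w\<in>cube A n. d w < r) \<Longrightarrow>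
    (\<exists>\<tau>. template A 1 n \<tau> \<and> (\<forall>x\<in>A. \<forall>y\<in>A. d (subst \<tau> (\<lambda>_. x)) = d (subst \<tau> (\<lambda>_. y))))"
    using insert.IH by metis
  obtain K where K: "\<And>d :: 'a list \<Rightarrow> nat. (\<forall>w\<in>cube (insert b A) K. d w < r) \<Longrightarrow>
    (\<exists>\<tau>. template (insert b A) n K \<tau> \<and>
      (\<forall>v i. (\<forall>j<n. v j \<in> insert b A) \<and> i < n \<longrightarrow>
        d (subst \<tau> (v(i := a))) = d (subst \<tau> (v(i := b)))))"
    using swap_invariant_template[of "insert b A" a b r n] insert.hyps a by auto
  show ?case
  proof (intro exI[of _ K] allI impI)
    fix d :: "'a list \<Rightarrow> nat"
    assume d: "\<forall>w\<in>cube (insert b A) K. d w < r"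
    obtain \<tau> where \<tau>: "template (insert b A) n K \<tau>"
      and swap: "\<And>v i. (\<forall>j<n. v j \<in> insert b A) \<Longrightarrow> i < n \<Longrightarrow>
        d (subst \<tau> (v(i := a))) = d (subst \<tau> (v(i := b)))"
      using K[OF d] by metis
    have "\<forall>w\<in>cube A n. d (subst \<tau> ((!) w)) < r"
      by (intro ballI d[rule_format] subst_in_cube[OF \<tau>])
        (force simp: cube_def dest: nth_mem)
    then obtain \<sigma> where \<sigma>: "template A 1 n \<sigma>"
      and mono: "\<And>x y. x \<in> A \<Longrightarrow> y \<in> A \<Longrightarrow>
        d (subst \<tau> ((!) (subst \<sigma> (\<lambda>_. x)))) = d (subst \<tau> ((!) (subst \<sigma> (\<lambda>_. y))))"
      using n[of "\<lambda>w. d (subst \<tau> ((!) w))"] by auto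
    have len: "length \<sigma> = n" using \<sigma> by (simp add: template_def)
    \<comment> \<open>Composition of templates: the entries of \<open>\<sigma>\<close> are put in
      for the variables of \<open>\<tau>\<close>.\<close>
    define \<upsilon> where "\<upsilon> = map (case_sum Inl (\<lambda>i. \<sigma> ! i)) \<tau>"
    have sub: "subst \<upsilon> v = subst \<tau> ((!) (subst \<sigma> v))" for v
      using \<tau> len by (fastforce simp: \<upsilon>_def subst_def template_def split: sum.splits)
    have \<upsilon>: "template (insert b A) 1 K \<upsilon>"
    proof -
      have "Inr 0 \<in> set \<sigma>" using \<sigma> by (auto simp: template_def)
      then obtain i where i: "i < n" "\<sigma> ! i = Inr 0"
        using len by (auto simp: in_set_conv_nth)
      have "Inr i \<in> set \<tau>" using \<tau> i by (auto simp: template_def)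
      then have "Inr 0 \<in> set \<upsilon>"
        using i by (force simp: \<upsilon>_def image_iff)
      moreover have "set \<upsilon> \<subseteq> insert b A <+> {..<1}"
      proof -
        have "case_sum Inl ((!) \<sigma>) z \<in> insert b A <+> {..<1}" if "z \<in> insert b A <+> {..<n}" for z
          using that
        proof (rule PlusE)
          fix i assume "i \<in> {..<n}" "z = Inr i"
          then show ?thesis using template_nth[OF \<sigma>, of i] by auto
        qed auto
        then show ?thesis using \<tau> by (auto simp: \<upsilon>_def template_def)
      qed
      moreover have "length \<upsilon> = K" using \<tau> by (simp add: \<upsilon>_def template_def)
      ultimately show ?thesis by (simp add: template_def lessThan_Suc)
    qed
    \<comment> \<open>The choice of \<open>\<sigma>\<close> says nothing about the letter
      \<open>b\<close>. Passing from \<open>a\<close> to \<open>b\<close> on the line changes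
      exactly the variables of \<open>\<tau>\<close> in the moving block \<open>S\<close> of
      \<open>\<sigma>\<close>, so swap invariance applies.\<close>
    have ab: "d (subst \<upsilon> (\<lambda>_. b)) = d (subst \<upsilon> (\<lambda>_. a))"
    proof -
      define S where "S = {i. i < n \<and> \<sigma> ! i = Inr 0}"
      define v where "v = (!) (subst \<sigma> (\<lambda>_. a))"
      have "subst \<sigma> (\<lambda>_. a) \<in> cube A n"
        by (rule subst_in_cube[OF \<sigma>]) (use a in auto)
      then have v: "\<forall>j<n. v j \<in> insert b A"
        by (auto simp: v_def cube_def dest: nth_mem)
      have ov: "subst \<tau> ((!) (subst \<sigma> (\<lambda>_. x))) = subst \<tau> (override_on v (\<lambda>_. x) S)" for x
      proof (rule subst_cong[OF \<tau>])
        fix i assume "i < n"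
        then have "\<sigma> ! i \<in> A <+> {..<1}"
          by (rule template_nth[OF \<sigma>])
        with \<open>i < n\<close> len show "subst \<sigma> (\<lambda>_. x) ! i = override_on v (\<lambda>_. x) S i"
          by (auto simp: subst_def override_on_def S_def v_def)
      qed
      show ?thesis
        unfolding sub ov
        by (rule swap_invariant_override[where n = n and A = "insert b A" and f = "\<lambda>v. d (subst \<tau> v)", symmetric])
          (use swap v a in \<open>auto simp: S_def\<close>)
    qed
    have "d (subst \<upsilon> (\<lambda>_. x)) = d (subst \<upsilon> (\<lambda>_. a))" if "x \<in> insert b A" for x
      using that ab mono[of x a] a by (auto simp: sub)
    with \<upsilon> show "\<exists>\<tau>. template (insert b A) 1 K \<tau> \<and>
        (\<forall>x\<in>insert b A. \<forall>y\<in>insert b A. d (subst \<tau> (\<lambda>_. x)) = d (subst \<tau> (\<lambda>_. y)))"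
      by metis
  qed
qed

text \<open>An injection of \<open>C\<close> into the numbers below \<open>card C\<close> transfers
  the result to colours of any type.\<close>

lemma hales_jewett_line:
  fixes A :: "'a set" and C :: "'c set"
  assumes "finite A" "A \<noteq> {}" "finite C"
  obtains K where "\<And>d. (\<forall>w\<in>cube A K. d w \<in> C) \<Longrightarrow>
    \<exists>\<tau>. template A 1 K \<tau> \<and> (\<forall>x\<in>A. \<forall>y\<in>A. d (subst \<tau> (\<lambda>_. x)) = d (subst \<tau> (\<lambda>_. y)))"
proof -
  obtain g where g: "inj_on g C" "\<And>x. x \<in> C \<Longrightarrow> g x < card C"
    using finite_colours_to_nat[OF assms(3)] by metis
  obtain K where K: "\<And>d :: 'a list \<Rightarrow> nat. (\<forall>w\<in>cube A K. d w < card C) \<Longrightarrow>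
    (\<exists>\<tau>. template A 1 K \<tau> \<and> (\<forall>x\<in>A. \<forall>y\<in>A. d (subst \<tau> (\<lambda>_. x)) = d (subst \<tau> (\<lambda>_. y))))"
    using hales_jewett_line_nat[OF assms(1,2), of "card C"] by metis
  show ?thesis
  proof (rule that[of K])
    fix d assume d: "\<forall>w\<in>cube A K. d w \<in> C"
    then have "\<forall>w\<in>cube A K. g (d w) < card C" using g(2) by blast
    from K[OF this] obtain \<tau> where \<tau>: "template A 1 K \<tau>"
      and eq: "\<And>x y. x \<in> A \<Longrightarrow> y \<in> A \<Longrightarrow> g (d (subst \<tau> (\<lambda>_. x))) = g (d (subst \<tau> (\<lambda>_. y)))"
      by blast
    have "d (subst \<tau> (\<lambda>_. x)) \<in> C" if "x \<in> A" for x
      using d subst_in_cube[OF \<tau>] that by auto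
    then have "d (subst \<tau> (\<lambda>_. x)) = d (subst \<tau> (\<lambda>_. y))" if "x \<in> A" "y \<in> A" for x y
      using inj_onD[OF g(1), OF eq[OF that]] that by blast
    with \<tau> show "\<exists>\<tau>. template A 1 K \<tau> \<and>
        (\<forall>x\<in>A. \<forall>y\<in>A. d (subst \<tau> (\<lambda>_. x)) = d (subst \<tau> (\<lambda>_. y)))"
      by blast
  qed
qed

section \<open>Hales-Jewett for subspaces, and existence of the numbers\<close>

text \<open>A line over the alphabet \<open>A\<^sup>m\<close> is an \<open>m\<close>-dimensional subspace over \<open>A\<close>.\<close>

lemma hales_jewett_subspace:
  fixes A :: "'a set" and C :: "'c set"
  assumes A: "finite A" "A \<noteq> {}" "finite C"
  shows "\<exists>K0. \<forall>K\<ge>K0. \<forall>d. (\<forall>w\<in>cube A K. d w \<in> C) \<longrightarrow>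
    (\<exists>\<tau>. template A m K \<tau> \<and>
      (\<forall>v v'. (\<forall>i<m. v i \<in> A \<and> v' i \<in> A) \<longrightarrow> d (subst \<tau> v) = d (subst \<tau> v')))"
proof -
  obtain a where a: "a \<in> A" using A by auto
  have "replicate m a \<in> cube A m" using a by (auto simp: cube_def)
  then have ne: "cube A m \<noteq> {}" by auto
  obtain L where L: "\<And>d. (\<forall>w\<in>cube (cube A m) L. d w \<in> C) \<Longrightarrow>
    \<exists>\<tau>. template (cube A m) 1 L \<tau> \<and>
      (\<forall>x\<in>cube A m. \<forall>y\<in>cube A m. d (subst \<tau> (\<lambda>_. x)) = d (subst \<tau> (\<lambda>_. y)))"
    using hales_jewett_line[OF finite_cube[OF A(1)] ne A(3)] by metis
  show ?thesis
  proof (intro exI[of _ "L * m"] allI impI)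
    fix K d assume K: "L * m \<le> K" and d: "\<forall>w\<in>cube A K. d w \<in> C"
    \<comment> \<open>Fixing the surplus coordinates to \<open>a\<close> yields the claim for every
      \<open>K\<close> from \<open>L * m\<close> on.\<close>
    define pad where "pad = replicate (K - L * m) a"
    have len: "length (concat w) = L * m" if "length w = L" "\<forall>u\<in>set w. length u = m"
      for w :: "'b list list" and L
      using that by (induction w arbitrary: L) auto
    have "d (concat w @ pad) \<in> C" if "w \<in> cube (cube A m) L" for w
    proof -
      have "length (concat w) = L * m"
        using that by (intro len) (auto simp: cube_def)
      then have "concat w @ pad \<in> cube A K"
        using that K a by (fastforce simp: cube_def pad_def)
      then show ?thesis using d by blast
    qed
    then obtain \<sigma> where \<sigma>: "template (cube A m) 1 L \<sigma>"
      and eq: "\<And>x y. x \<in> cube A m \<Longrightarrow> y \<in> cube A m \<Longrightarrow>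
        d (concat (subst \<sigma> (\<lambda>_. x)) @ pad) = d (concat (subst \<sigma> (\<lambda>_. y)) @ pad)"
      using L[of "\<lambda>w. d (concat w @ pad)"] by auto
    \<comment> \<open>Each fixed letter of \<open>\<sigma>\<close>, itself a word of length
      \<open>m\<close>, is spelled out, and each occurrence of its variable becomes the block of all
      \<open>m\<close> variables.\<close>
    define \<tau> where
      "\<tau> = concat (map (case_sum (map Inl) (\<lambda>_. map Inr [0..<m])) \<sigma>) @ map Inl pad"
    have sub: "subst \<tau> v = concat (subst \<sigma> (\<lambda>_. map v [0..<m])) @ pad" for v
    proof -
      have "subst (concat (map (case_sum (map Inl) (\<lambda>_. map Inr [0..<m])) \<sigma>)) v
          = concat (subst \<sigma> (\<lambda>_. map v [0..<m]))" for \<sigma> :: "('a list + nat) list"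
        by (induction \<sigma>) (auto simp: subst_def o_def split: sum.splits)
      moreover have "subst (map Inl pad) v = pad"
        by (simp add: subst_def o_def)
      ultimately show ?thesis by (simp add: \<tau>_def subst_append)
    qed
    have "template A m K \<tau>"
    proof -
      have "length (concat (map (case_sum (map Inl) (\<lambda>_. map Inr [0..<m])) \<sigma>)) = L * m"
        using \<sigma> by (intro len) (auto simp: template_def cube_def)
      then have "length \<tau> = K" using K by (simp add: \<tau>_def pad_def)
      moreover have "set \<tau> \<subseteq> A <+> {..<m}"
      proof -
        have "set (case_sum (map Inl) (\<lambda>_. map Inr [0..<m]) z) \<subseteq> A <+> {..<m}" if "z \<in> set \<sigma>" for z
          using \<sigma> that by (cases z) (auto simp: template_def cube_def)
        moreover have "set (map Inl pad) \<subseteq> A <+> {..<m}"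
          using a by (auto simp: pad_def)
        ultimately show ?thesis by (auto simp: \<tau>_def)
      qed
      moreover have "Inr 0 \<in> set \<sigma>" using \<sigma> by (auto simp: template_def)
      then have "Inr ` {..<m} \<subseteq> set \<tau>"
        by (force simp: \<tau>_def)
      ultimately show ?thesis by (simp add: template_def)
    qed
    moreover have "d (subst \<tau> v) = d (subst \<tau> v')" if "\<forall>i<m. v i \<in> A \<and> v' i \<in> A" for v v'
      unfolding sub using that by (intro eq) (auto simp: cube_def)
    ultimately show "\<exists>\<tau>. template A m K \<tau> \<and>
      (\<forall>v v'. (\<forall>i<m. v i \<in> A \<and> v' i \<in> A) \<longrightarrow> d (subst \<tau> v) = d (subst \<tau> v'))"
      by blast
  qed
qed

text \<open>All large \<open>K\<close> are covered, and not just one, because \<open>f8_star\<close>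
  admits only multiples of the alphabet size.\<close>

lemma HJ_property_eventually:
  fixes \<Lambda> :: "'a set" and C :: "'c set"
  assumes "finite \<Lambda>" "\<Lambda> \<noteq> {}" "finite C"
  shows "\<exists>K0. \<forall>K\<ge>K0. 0 < K \<longrightarrow> HJ_property C m \<Lambda> K"
proof -
  obtain K0 where K0: "\<And>K d. K0 \<le> K \<Longrightarrow> (\<forall>w\<in>cube \<Lambda> K. d w \<in> C) \<Longrightarrow>
    \<exists>\<tau>. template \<Lambda> m K \<tau> \<and>
      (\<forall>v v'. (\<forall>i<m. v i \<in> \<Lambda> \<and> v' i \<in> \<Lambda>) \<longrightarrow> d (subst \<tau> v) = d (subst \<tau> v'))"
    using hales_jewett_subspace[OF assms, of m] by blast
  show ?thesis
  proof (intro exI[of _ K0] allI impI)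
    fix K assume K: "K0 \<le> K" "0 < K"
    show "HJ_property C m \<Lambda> K"
      unfolding HJ_property_def
    proof (intro allI impI ballI)
      fix M :: "nat set" and r d
      assume M: "linear_order_on M r \<and> card M = K" and d: "d \<in> words M \<Lambda> \<rightarrow> C"
      \<comment> \<open>Infinite sets have cardinality 0, so \<open>0 < K\<close> gives
        finiteness.\<close>
      then have "finite M" using K by (intro card_ge_0_finite) auto
      then obtain p where p: "bij_betw p M {0..<K}"
        using ex_bij_betw_finite_nat[of M] M by auto
      have pK: "p x < K" if "x \<in> M" for x
        using p that by (auto simp: bij_betw_def)
      \<comment> \<open>The enumeration \<open>p\<close> of \<open>M\<close> turns a list of length
        \<open>K\<close> into a function on \<open>M\<close>.\<close>
      define W where "W w = (\<lambda>x\<in>M. w ! p x)" for w :: "'a list"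
      have "d (W w) \<in> C" if "w \<in> cube \<Lambda> K" for w
      proof -
        have "W w \<in> words M \<Lambda>"
          using that pK by (auto simp: W_def words_def cube_def)
        then show ?thesis using d by auto
      qed
      then obtain \<tau> where \<tau>: "template \<Lambda> m K \<tau>"
        and eq: "\<And>v v'. (\<forall>i<m. v i \<in> \<Lambda> \<and> v' i \<in> \<Lambda>) \<Longrightarrow> d (W (subst \<tau> v)) = d (W (subst \<tau> v'))"
        using K0[OF K(1), of "\<lambda>w. d (W w)"] by auto
      have len: "length \<tau> = K" using \<tau> by (simp add: template_def)
      have \<tau>_nth: "\<tau> ! p x \<in> \<Lambda> <+> {..<m}" if "x \<in> M" for x
        by (rule template_nth[OF \<tau> pK[OF that]])
      define N where "N l = {x \<in> M. \<tau> ! p x = Inr l}" for l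
      define \<rho> where "\<rho> = (\<lambda>x\<in>M - (\<Union>l<m. N l). projl (\<tau> ! p x))"
      have ne: "N l \<noteq> {}" if "l < m" for l
      proof -
        have "Inr l \<in> set \<tau>" using \<tau> that by (auto simp: template_def)
        then obtain j where j: "j < K" "\<tau> ! j = Inr l"
          using len by (auto simp: in_set_conv_nth)
        then have "j \<in> p ` M" using p by (auto simp: bij_betw_def)
        with j show ?thesis by (auto simp: N_def)
      qed
      have "subspace_data M \<Lambda> m N \<rho>"
        unfolding subspace_data_def
      proof (intro conjI allI impI ne)
        show "N l \<subseteq> M" for l by (auto simp: N_def)
        show "disjoint_family_on N {..<m}" by (auto simp: disjoint_family_on_def N_def)
        have "projl (\<tau> ! p x) \<in> \<Lambda>" if "x \<in> M - (\<Union>l<m. N l)" for x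
          using \<tau>_nth[of x] that by (cases "\<tau> ! p x") (auto simp: N_def)
        then show "\<rho> \<in> M - (\<Union>l<m. N l) \<rightarrow>\<^sub>E \<Lambda>"
          by (auto simp: \<rho>_def)
      qed
      moreover have "d constant_on word_subspace M \<Lambda> m N \<rho>"
      proof -
        have rep: "\<exists>v. (\<forall>i<m. v i \<in> \<Lambda>) \<and> \<nu> = W (subst \<tau> v)"
          if "\<nu> \<in> word_subspace M \<Lambda> m N \<rho>" for \<nu>
        proof -
          have \<nu>: "\<nu> \<in> words M \<Lambda>" "restrict \<nu> (M - (\<Union>l<m. N l)) = \<rho>"
            and "\<forall>l<m. \<exists>y. \<forall>x\<in>N l. \<nu> x = y"
            using that by (auto simp: word_subspace_def constant_on_def)
          then obtain v where v: "\<And>l x. l < m \<Longrightarrow> x \<in> N l \<Longrightarrow> \<nu> x = v l"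
            by metis
          have "v l \<in> \<Lambda>" if "l < m" for l
          proof -
            obtain x where x: "x \<in> N l" using ne \<open>l < m\<close> by auto
            moreover have "x \<in> M" using x by (simp add: N_def)
            ultimately show ?thesis using v[OF that x] \<nu>(1) by (metis words_def PiE_mem)
          qed
          moreover have "\<nu> = W (subst \<tau> v)"
          proof
            fix x
            show "\<nu> x = W (subst \<tau> v) x"
            proof (cases "x \<in> M")
              case False
              then show ?thesis using \<nu>(1) by (auto simp: W_def words_def)
            next
              case True
              show ?thesis
              proof (cases "\<tau> ! p x")
                case (Inl y)
                then have "x \<in> M - (\<Union>l<m. N l)" using True by (auto simp: N_def)
                with fun_cong[OF \<nu>(2), of x] Inl True show ?thesis
                  using pK[OF True] len by (auto simp: \<rho>_def W_def subst_def)
              next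
                case (Inr l)
                then have "l < m" "x \<in> N l" using True \<tau>_nth[OF True] by (auto simp: N_def)
                with v Inr True show ?thesis
                  using pK[OF True] len by (auto simp: W_def subst_def)
              qed
            qed
          qed
          ultimately show ?thesis by blast
        qed
        obtain a where a: "a \<in> \<Lambda>" using assms(2) by auto
        have "d \<nu> = d (W (subst \<tau> (\<lambda>_. a)))" if "\<nu> \<in> word_subspace M \<Lambda> m N \<rho>" for \<nu>
          using rep[OF that] eq a by metis
        then show ?thesis by (auto simp: constant_on_def)
      qed
      ultimately show "\<exists>N \<rho>. subspace_data M \<Lambda> m N \<rho> \<and> d constant_on word_subspace M \<Lambda> m N \<rho>"
        by blast
    qed
  qed
qed

text \<open>A constant colouring depends on the letter counts trivially; hence the minimum in
  \<open>f8_star\<close> is over a non-empty set.\<close>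

lemma HJ_property_imp_f8_property:
  assumes "HJ_property C m \<Lambda> k"
  shows "f8_property \<Lambda> m C k"
  unfolding f8_property_def
proof (intro allI impI ballI)
  fix M :: "nat set" and r d
  assume "linear_order_on M r \<and> card M = k" "d \<in> words M \<Lambda> \<rightarrow> C"
  then obtain N \<rho> where "subspace_data M \<Lambda> m N \<rho>" "d constant_on word_subspace M \<Lambda> m N \<rho>"
    using assms unfolding HJ_property_def by blast
  then show "\<exists>N \<rho>. subspace_data M \<Lambda> m N \<rho> \<and>
      (\<forall>\<nu>1 \<in> word_subspace M \<Lambda> m N \<rho>. \<forall>\<nu>2 \<in> word_subspace M \<Lambda> m N \<rho>.
        (\<forall>\<alpha>\<in>\<Lambda>. letter_count m N \<nu>1 \<alpha> = letter_count m N \<nu>2 \<alpha>) \<longrightarrow> d \<nu>1 = d \<nu>2)"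
    by (intro exI[of _ N] exI[of _ \<rho>]) (auto simp: constant_on_def)
qed

section \<open>Existence of the Gallai-Witt number for cubes\<close>

text \<open>
  Summing the letters of a word over the alphabet \<open>{0, 1}\<^sup>h\<close> sends a combinatorial line to a
  homothetic copy of \<open>{0, 1}\<^sup>h\<close>.
\<close>

lemma GW_property_exists:
  fixes C :: "'c set"
  assumes "finite C"
  shows "\<exists>n. GW_property C h 1 n"
proof -
  define A :: "(nat \<Rightarrow> nat) set" where "A = {..<h} \<rightarrow>\<^sub>E {..1}"
  have "finite A" unfolding A_def by (intro finite_PiE) auto
  moreover have "A \<noteq> {}" by (simp add: A_def PiE_eq_empty_iff)
  ultimately obtain K where K: "\<And>d. (\<forall>w\<in>cube A K. d w \<in> C) \<Longrightarrow>
    \<exists>\<tau>. template A 1 K \<tau> \<and> (\<forall>x\<in>A. \<forall>y\<in>A. d (subst \<tau> (\<lambda>_. x)) = d (subst \<tau> (\<lambda>_. y)))"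
    using hales_jewett_line[OF _ _ assms] by metis
  have "GW_property C h 1 (Suc K)"
    unfolding GW_property_def
  proof
    fix c assume c: "c \<in> words {..<h} {..<Suc K} \<rightarrow> C"
    define s where "s w = (\<lambda>e\<in>{..<h}. \<Sum>u\<leftarrow>w. u e)" for w :: "(nat \<Rightarrow> nat) list"
    have "c (s w) \<in> C" if "w \<in> cube A K" for w
    proof -
      \<comment> \<open>Each of the \<open>K\<close> letters adds at most 1 to a coordinate, whence
        the bound \<open>Suc K\<close>.\<close>
      have "(\<Sum>u\<leftarrow>w. u e) \<le> length w" if "set w \<subseteq> A" "e < h" for w e
        using that by (induction w) (force simp: A_def PiE_iff)+
      then have "s w \<in> words {..<h} {..<Suc K}"
        using that by (force simp: s_def words_def cube_def less_Suc_eq_le)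
      then show ?thesis using c by auto
    qed
    then obtain \<tau> where \<tau>: "template A 1 K \<tau>"
      and eq: "\<And>x y. x \<in> A \<Longrightarrow> y \<in> A \<Longrightarrow> c (s (subst \<tau> (\<lambda>_. x))) = c (s (subst \<tau> (\<lambda>_. y)))"
      using K[of "\<lambda>w. c (s w)"] by auto
    \<comment> \<open>On the line, \<open>D\<close> counts the moving positions and is the dilation
      factor; \<open>b\<close> sums the fixed letters and is the base point.\<close>
    define D :: "((nat \<Rightarrow> nat) + nat) list \<Rightarrow> nat" where "D \<tau> = (\<Sum>z\<leftarrow>\<tau>. case_sum (\<lambda>_. 0) (\<lambda>_. 1) z)" for \<tau>
    define b where "b \<tau> e = (\<Sum>z\<leftarrow>\<tau>. case_sum (\<lambda>u. u e) (\<lambda>_. 0) z)"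
      for \<tau> :: "((nat \<Rightarrow> nat) + nat) list" and e
    have sum: "(\<Sum>u\<leftarrow>subst \<tau> (\<lambda>_. x). u e) = b \<tau> e + D \<tau> * x e" for x \<tau> e
      by (induction \<tau>) (auto simp: subst_def b_def D_def split: sum.splits)
    \<comment> \<open>A position is either fixed or moving, so it adds at most 1 to this
      sum.\<close>
    have "b \<tau> e + D \<tau> \<le> length \<tau>" if "set \<tau> \<subseteq> A <+> {..<1}" "e < h" for \<tau> e
      using that(1)
    proof (induction \<tau>)
      case (Cons z \<tau>)
      have "case_sum (\<lambda>u. u e) (\<lambda>_. 0) z + case_sum (\<lambda>_. 0) (\<lambda>_. 1) z \<le> 1"
        using Cons.prems \<open>e < h\<close> by (cases z) (auto simp: A_def PiE_iff)
      with Cons show ?case by (simp add: b_def D_def del: One_nat_def)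
    qed (simp add: b_def D_def)
    then have "\<forall>e<h. b \<tau> e + D \<tau> * 1 < Suc K"
      using \<tau> by (auto simp: template_def less_Suc_eq_le)
    moreover have "0 < D \<tau>"
    proof -
      have "0 < D \<tau>" if "Inr 0 \<in> set \<tau>" for \<tau>
        using that by (induction \<tau>) (auto simp: D_def)
      then show ?thesis using \<tau> by (auto simp: template_def)
    qed
    moreover have "c constant_on {(\<lambda>e\<in>{..<h}. b \<tau> e + D \<tau> * i e) | i. \<forall>e<h. i e \<le> 1}"
      unfolding constant_on_def
    proof (intro exI ballI)
      fix x assume "x \<in> {(\<lambda>e\<in>{..<h}. b \<tau> e + D \<tau> * i e) | i. \<forall>e<h. i e \<le> 1}"
      then obtain i where i: "x = (\<lambda>e\<in>{..<h}. b \<tau> e + D \<tau> * i e)" "\<forall>e<h. i e \<le> 1" by auto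
      have "x = s (subst \<tau> (\<lambda>_. restrict i {..<h}))"
        unfolding s_def sum i by auto
      moreover have "restrict i {..<h} \<in> A" "(\<lambda>e\<in>{..<h}. 0) \<in> A"
        using i by (auto simp: A_def)
      ultimately show "c x = c (s (subst \<tau> (\<lambda>_. (\<lambda>e\<in>{..<h}. 0))))"
        using eq by metis
    qed
    ultimately show "\<exists>d>0. \<exists>b. (\<forall>e<h. b e + d * 1 < Suc K) \<and>
        c constant_on {(\<lambda>e\<in>{..<h}. b e + d * i e) | i. \<forall>e<h. i e \<le> 1}"
      by blast
  qed
  then show ?thesis by blast
qed

section \<open>From letter counts to a monochromatic line\<close>

text \<open>Used to distribute the blocks of a subspace among the letters, and one extra class of
  moving blocks, in prescribed numbers.\<close>

lemma ex_partition_with_cards: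
  fixes a :: "nat \<Rightarrow> nat"
  shows "\<exists>g. (\<forall>l < sum a {..<k}. g l < k) \<and> (\<forall>f<k. card {l. l < sum a {..<k} \<and> g l = f} = a f)"
proof (induction k)
  case 0
  show ?case by simp
next
  case (Suc k)
  then obtain g where g: "\<And>l. l < sum a {..<k} \<Longrightarrow> g l < k"
    "\<And>f. f < k \<Longrightarrow> card {l. l < sum a {..<k} \<and> g l = f} = a f" by auto
  define g' where "g' l = (if l < sum a {..<k} then g l else k)" for l
  have "{l. l < sum a {..<Suc k} \<and> g' l = f} = {l. l < sum a {..<k} \<and> g l = f}" if "f < k" for f
    using that by (auto simp: g'_def)
  moreover have "{l. l < sum a {..<Suc k} \<and> g' l = k} = {sum a {..<k}..<sum a {..<Suc k}}"
  proof (rule set_eqI)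
    fix l
    show "l \<in> {l. l < sum a {..<Suc k} \<and> g' l = k} \<longleftrightarrow> l \<in> {sum a {..<k}..<sum a {..<Suc k}}"
      using g(1)[of l] by (cases "l < sum a {..<k}") (auto simp: g'_def)
  qed
  moreover have "g' l < Suc k" for l
    using g(1) by (auto simp: g'_def less_SucI)
  ultimately show ?case
    by (intro exI[of _ g']) (auto simp: less_Suc_eq g(2))
qed

text \<open>
  The map \<open>x \<mapsto> (h x\<^sub>e - \<Sum>\<^sub>j x\<^sub>j + h n)\<^sub>e\<close> sends \<open>{0..<n}\<^sup>h\<close> into the letter counts of total
  \<open>h\<^sup>2 n\<close>, and it sends the points \<open>b + D 1\<^sub>e\<close> to counts that differ only by which letter
  occupies \<open>h D\<close> of the blocks.
\<close>

lemma f8_property_imp_HJ_property: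
  fixes \<Lambda> :: "'a set" and C :: "'c set"
  assumes \<Lambda>: "finite \<Lambda>" "\<Lambda> \<noteq> {}" and C: "C \<noteq> {}"
    and GW: "GW_property C (card \<Lambda>) 1 n"
    and f8: "f8_property \<Lambda> ((card \<Lambda>)\<^sup>2 * n) C k"
  shows "HJ_property C 1 \<Lambda> k"
  unfolding HJ_property_def
proof (intro allI impI ballI)
  fix M :: "nat set" and r d
  assume M: "linear_order_on M r \<and> card M = k" and d: "d \<in> words M \<Lambda> \<rightarrow> C"
  define h where "h = card \<Lambda>"
  define m where "m = h\<^sup>2 * n"
  have h: "0 < h" using \<Lambda> by (simp add: h_def card_gt_0_iff)
  obtain \<alpha> where \<alpha>: "bij_betw \<alpha> {0..<h} \<Lambda>"
    unfolding h_def using ex_bij_betw_nat_finite[OF \<Lambda>(1)] by blast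
  have \<alpha>_eq: "\<alpha> e = \<alpha> f \<longleftrightarrow> e = f" if "e < h" "f < h" for e f
    using \<alpha> that by (auto simp: bij_betw_def inj_on_def)
  have \<alpha>_in: "\<alpha> e \<in> \<Lambda>" if "e < h" for e
    using \<alpha> that by (auto simp: bij_betw_def)
  have \<alpha>_ex: "\<exists>e<h. x = \<alpha> e" if "x \<in> \<Lambda>" for x
    using \<alpha> that by (auto simp: bij_betw_def)
  obtain N \<rho> where sd: "subspace_data M \<Lambda> m N \<rho>"
    and sym: "\<And>\<nu>1 \<nu>2. \<nu>1 \<in> word_subspace M \<Lambda> m N \<rho> \<Longrightarrow> \<nu>2 \<in> word_subspace M \<Lambda> m N \<rho> \<Longrightarrow>
      (\<forall>\<alpha>\<in>\<Lambda>. letter_count m N \<nu>1 \<alpha> = letter_count m N \<nu>2 \<alpha>) \<Longrightarrow> d \<nu>1 = d \<nu>2"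
    using f8 M d unfolding f8_property_def h_def m_def by metis
  have N: "\<And>l. l < m \<Longrightarrow> N l \<noteq> {}" "\<And>l. l < m \<Longrightarrow> N l \<subseteq> M"
    and disj: "\<And>l l' x. l < m \<Longrightarrow> l' < m \<Longrightarrow> x \<in> N l \<Longrightarrow> x \<in> N l' \<Longrightarrow> l = l'"
    and \<rho>: "\<rho> \<in> (M - (\<Union>l<m. N l)) \<rightarrow>\<^sub>E \<Lambda>"
    using sd unfolding subspace_data_def disjoint_family_on_def by blast+
  \<comment> \<open>The coordinates of \<open>y x\<close> add up to \<open>h * h * n\<close> if no
    subtraction is truncated. At the points used below the sum of \<open>x\<close> is
    \<open>B + D\<close>, and \<open>BD\<close> rules truncation out.\<close>
  define y where "y x e = h * x e + h * n - (\<Sum>j<h. x j)" for x e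
  define P where "P x w \<longleftrightarrow> w \<in> word_subspace M \<Lambda> m N \<rho> \<and>
      (\<forall>e<h. letter_count m N w (\<alpha> e) = y x e)" for x w
  obtain c0 where c0: "c0 \<in> C" using C by auto
  \<comment> \<open>By \<open>sym\<close> the colour does not depend on the chosen word. The default
    \<open>c0\<close> keeps \<open>c\<close> in \<open>C\<close> without a proof that every count
    vector is realised.\<close>
  define c where "c x = (if \<exists>w. P x w then d (SOME w. P x w) else c0)" for x
  have c_eq: "c x = d w" if "P x w" for x w
  proof -
    have "P x (SOME w. P x w)" using that by (rule someI[of "P x"])
    then have "d (SOME w. P x w) = d w"
      using that \<alpha>_ex unfolding P_def by (intro sym) fastforce+
    then show ?thesis using that by (auto simp: c_def)
  qed
  have "c x \<in> C" for x
  proof (cases "\<exists>w. P x w")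
    case True
    then obtain w where w: "P x w" by blast
    then have "w \<in> words M \<Lambda>" by (simp add: P_def word_subspace_def)
    then show ?thesis using c_eq[OF w] d by auto
  qed (use c0 in \<open>simp add: c_def\<close>)
  then have "c \<in> words {..<h} {..<n} \<rightarrow> C" by simp
  from bspec[OF GW[unfolded GW_property_def, folded h_def] this]
  obtain D b where D: "0 < D" and b': "\<forall>e<h. b e + D * 1 < n"
    and const: "c constant_on {(\<lambda>e\<in>{..<h}. b e + D * i e) | i. \<forall>e<h. i e \<le> 1}"
    by blast
  have b: "b e + D < n" if "e < h" for e
    using b' that by simp
  define B where "B = sum b {..<h}"
  have BD: "B + D \<le> h * n"
  proof -
    have "(\<Sum>e<h. b e + D) \<le> (\<Sum>e<h. n)"
      using b by (intro sum_mono) (simp add: less_imp_le)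
    then have "B + h * D \<le> h * n" by (simp add: B_def sum.distrib)
    moreover have "D \<le> h * D" using h by simp
    ultimately show ?thesis by linarith
  qed
  \<comment> \<open>For \<open>f < h\<close> this is the count of letter \<open>f\<close> at the
    point \<open>b\<close> plus \<open>D\<close> times a unit vector, less the \<open>h * D\<close>
    blocks that the letter singled out gains. Class \<open>h\<close> holds those moving
    blocks.\<close>
  define a where "a f = (if f = h then h * D else h * b f + h * n - (B + D))" for f
  have sum_a: "sum a {..<Suc h} = m"
  proof -
    have "(\<Sum>f<h. a f + (B + D)) = (\<Sum>f<h. h * b f + h * n)"
      using BD by (intro sum.cong) (auto simp: a_def)
    then have "sum a {..<h} + h * (B + D) = h * B + h * (h * n)"
      by (simp add: sum.distrib B_def sum_distrib_left)
    then show ?thesis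
      by (simp add: a_def m_def power2_eq_square algebra_simps)
  qed
  obtain g where g: "\<And>l. l < m \<Longrightarrow> g l < Suc h"
    and card_g: "\<And>f. f < Suc h \<Longrightarrow> card {l. l < m \<and> g l = f} = a f"
    using ex_partition_with_cards[of a "Suc h"] unfolding sum_a by blast
  \<comment> \<open>All moving blocks merge into one block of a line. It is non-empty since
    \<open>h * D > 0\<close>.\<close>
  define L where "L = (\<Union>l\<in>{l. l < m \<and> g l = h}. N l)"
  define idx where "idx x = (THE l. l < m \<and> x \<in> N l)" for x
  have idx: "idx x = l" if "l < m" "x \<in> N l" for l x
    unfolding idx_def using that disj by (intro the_equality) auto
  \<comment> \<open>Blocks in a class below \<open>h\<close> receive the letter of their class; off
    the blocks \<open>\<rho>\<close> is kept.\<close>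
  define \<rho>' where "\<rho>' = (\<lambda>x\<in>M - L. if x \<in> (\<Union>l<m. N l) then \<alpha> (g (idx x)) else \<rho> x)"
  have L_sub: "L \<subseteq> M" using N by (auto simp: L_def)
  have L_ne: "L \<noteq> {}"
  proof -
    have "card {l. l < m \<and> g l = h} \<noteq> 0"
      using card_g[of h] h D by (simp add: a_def)
    then obtain l where "l < m" "g l = h" by (auto simp: card_eq_0_iff)
    then show ?thesis using N(1)[of l] by (auto simp: L_def)
  qed
  have L_iff: "x \<in> L \<longleftrightarrow> g l = h" if "l < m" "x \<in> N l" for l x
    using that disj by (auto simp: L_def)
  have "subspace_data M \<Lambda> 1 (\<lambda>_. L) \<rho>'"
  proof -
    have "\<rho>' x \<in> \<Lambda>" if x: "x \<in> M - L" for x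
    proof (cases "x \<in> (\<Union>l<m. N l)")
      case True
      then obtain l where l: "l < m" "x \<in> N l" by auto
      then have "g l < h" using L_iff[OF l] x g[of l] by auto
      then show ?thesis using x True l by (auto simp: \<rho>'_def idx \<alpha>_in)
    next
      case False
      then show ?thesis using x \<rho> by (auto simp: \<rho>'_def PiE_iff)
    qed
    then have "\<rho>' \<in> M - L \<rightarrow>\<^sub>E \<Lambda>"
      by (intro PiE_I) (auto simp: \<rho>'_def)
    then show ?thesis
      using L_ne L_sub by (simp add: subspace_data_def disjoint_family_on_def lessThan_Suc)
  qed
  moreover have "d constant_on word_subspace M \<Lambda> 1 (\<lambda>_. L) \<rho>'"
  proof -
    \<comment> \<open>If \<open>w\<close> has letter \<open>\<alpha> e\<close> on \<open>L\<close>,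
      its counts are those of \<open>b\<close> plus \<open>D\<close> times the unit vector of
      \<open>e\<close>.\<close>
    have point: "\<exists>e<h. d w = c (\<lambda>j\<in>{..<h}. b j + D * (if j = e then 1 else 0))"
      if w: "w \<in> word_subspace M \<Lambda> 1 (\<lambda>_. L) \<rho>'" for w
    proof -
      have w_words: "w \<in> words M \<Lambda>" and w_restr: "restrict w (M - L) = \<rho>'"
        and "\<exists>z. \<forall>x\<in>L. w x = z"
        using w by (auto simp: word_subspace_def constant_on_def)
      then obtain z where z: "\<And>x. x \<in> L \<Longrightarrow> w x = z" by blast
      have "z \<in> \<Lambda>"
        using L_ne L_sub z w_words unfolding words_def by (metis PiE_mem all_not_in_conv subsetD)
      then obtain e where e: "e < h" "z = \<alpha> e" using \<alpha>_ex by blast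
      have off: "w x = \<rho>' x" if "x \<in> M" "x \<notin> L" for x
        using fun_cong[OF w_restr, of x] that by simp
      have block: "w x = (if g l = h then \<alpha> e else \<alpha> (g l))" if "l < m" "x \<in> N l" for l x
      proof (cases "g l = h")
        case True
        then show ?thesis using z e L_iff[OF that] by simp
      next
        case False
        then have "x \<in> M" "x \<notin> L" "x \<in> (\<Union>l<m. N l)"
          using that N(2)[OF that(1)] L_iff[OF that] by auto
        then show ?thesis
          using off[of x] idx[OF that] False by (simp add: \<rho>'_def)
      qed
      define x where "x = (\<lambda>j\<in>{..<h}. b j + D * (if j = e then 1 else 0))"
      have "w \<in> word_subspace M \<Lambda> m N \<rho>"
      proof -
        have "restrict w (M - (\<Union>l<m. N l)) = \<rho>"
        proof
          fix x
          show "restrict w (M - (\<Union>l<m. N l)) x = \<rho> x"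
          proof (cases "x \<in> M - (\<Union>l<m. N l)")
            case True
            then have "x \<in> M - L" by (auto simp: L_def)
            with True show ?thesis using off[of x] by (auto simp: \<rho>'_def)
          next
            case False
            then show ?thesis using PiE_arb[OF \<rho> False] by auto
          qed
        qed
        moreover have "\<forall>l<m. w constant_on N l"
          using block by (auto simp: constant_on_def)
        ultimately show ?thesis using w_words by (simp add: word_subspace_def)
      qed
      moreover have "letter_count m N w (\<alpha> f) = y x f" if f: "f < h" for f
      proof -
        have "(\<forall>x\<in>N l. w x = \<alpha> f) \<longleftrightarrow> g l = f \<or> (f = e \<and> g l = h)" if l: "l < m" for l
        proof -
          have "(\<forall>x\<in>N l. w x = \<alpha> f) \<longleftrightarrow> (if g l = h then \<alpha> e else \<alpha> (g l)) = \<alpha> f"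
            using block[OF l] N(1)[OF l] by auto
          also have "\<dots> \<longleftrightarrow> g l = f \<or> (f = e \<and> g l = h)"
            using g[OF l] f e \<alpha>_eq[of e f] \<alpha>_eq[of "g l" f] by (auto simp: less_Suc_eq)
          finally show ?thesis .
        qed
        then have "{l. l < m \<and> (\<forall>x\<in>N l. w x = \<alpha> f)} =
            {l. l < m \<and> g l = f} \<union> (if f = e then {l. l < m \<and> g l = h} else {})"
          by auto
        then have "letter_count m N w (\<alpha> f) =
            card ({l. l < m \<and> g l = f} \<union> (if f = e then {l. l < m \<and> g l = h} else {}))"
          by (simp add: letter_count_def)
        also have "\<dots> = a f + (if f = e then a h else 0)"
          using f by (subst card_Un_disjoint) (auto simp: card_g)
        also have "\<dots> = y x f"
        proof -
          have "(\<Sum>j<h. x j) = (\<Sum>j<h. b j + (if j = e then D else 0))"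
            by (intro sum.cong) (auto simp: x_def)
          also have "\<dots> = B + D"
            using e by (simp add: sum.distrib B_def)
          finally show ?thesis
            using f BD by (auto simp: y_def a_def x_def algebra_simps)
        qed
        finally show ?thesis .
      qed
      ultimately have "P x w" by (simp add: P_def)
      then have "d w = c x" using c_eq by simp
      then show ?thesis using e(1) unfolding x_def by blast
    qed
    obtain t where t: "\<And>x. x \<in> {(\<lambda>e\<in>{..<h}. b e + D * i e) | i. \<forall>e<h. i e \<le> 1} \<Longrightarrow> c x = t"
      using const unfolding constant_on_def by blast
    \<comment> \<open>Unit vectors have entries at most 1, so these points lie in the monochromatic
      copy.\<close>
    have "c (\<lambda>j\<in>{..<h}. b j + D * (if j = e then 1 else 0)) = t" for e
      by (intro t CollectI exI[of _ "\<lambda>j. if j = e then 1 else 0"]) simp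
    then show ?thesis using point unfolding constant_on_def by metis
  qed
  ultimately show "\<exists>N \<rho>. subspace_data M \<Lambda> 1 N \<rho> \<and> d constant_on word_subspace M \<Lambda> 1 N \<rho>"
    by blast
qed

theorem mainTheorem1:
  fixes \<Lambda> :: "'a set" and C :: "'c set"
  assumes "finite \<Lambda>" and "\<Lambda> \<noteq> {}" and "finite C" and "C \<noteq> {}"
  shows "HJ C 1 \<Lambda> \<le> f8_star \<Lambda> ((card \<Lambda>)\<^sup>2 * GW C (card \<Lambda>) 1) C"
proof -
  define m where "m = (card \<Lambda>)\<^sup>2 * GW C (card \<Lambda>) 1"
  define k where "k = f8_star \<Lambda> m C"
  have GW: "GW_property C (card \<Lambda>) 1 (GW C (card \<Lambda>) 1)"
    unfolding GW_def by (rule LeastI_ex[OF GW_property_exists[OF assms(3)]])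
  obtain K0 where K0: "\<And>K. K0 \<le> K \<Longrightarrow> 0 < K \<Longrightarrow> HJ_property C m \<Lambda> K"
    using HJ_property_eventually[OF assms(1-3), of m] by blast
  have "0 < card \<Lambda>" using assms by (simp add: card_gt_0_iff)
  \<comment> \<open>A positive multiple of the alphabet size beyond \<open>K0\<close> witnesses that
    the minimum \<open>k\<close> is attained.\<close>
  then have K: "K0 \<le> card \<Lambda> * Suc K0" "0 < card \<Lambda> * Suc K0"
    by (cases "card \<Lambda>"; simp)+
  then have "0 < card \<Lambda> * Suc K0 \<and> card \<Lambda> dvd card \<Lambda> * Suc K0 \<and> f8_property \<Lambda> m C (card \<Lambda> * Suc K0)"
    using HJ_property_imp_f8_property[OF K0[OF K]] by simp
  then have "0 < k \<and> card \<Lambda> dvd k \<and> f8_property \<Lambda> m C k"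
    unfolding k_def f8_star_def by (rule LeastI)
  then have "0 < k \<and> HJ_property C 1 \<Lambda> k"
    using f8_property_imp_HJ_property[OF assms(1,2,4) GW] by (simp add: m_def)
  then show ?thesis
    unfolding HJ_def k_def m_def by (rule Least_le)
qed

end
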